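(* Let $N$ be a $\mathbb{C}$-algebra which is generated by elements $x,y$, and suppose that for some natural number $n$ the elements $1,x,\dots,x^n$ and $y,yx,\dots,yx^n$ span $N$ as a linear space over $\mathbb{C}$. Let $A$ be a semisimple $\mathbb{C}$-algebra of the same dimension as $N$ which contains, as a direct summand, a matrix algebra $M_j(\mathbb{C})$ with $j>2$. Then $N$ cannot be strongly flatly deformed to $A$; that is, there is no strongly flat deformation from $N$ to $A$.
   Context: All algebras are associative with identity, usually noncommutative. $\mathbb{C}\{t\}$ denotes the ring of power series in $t$ with coefficients in $\mathbb{C}$, and for a finite-dimensional $\mathbb{C}$-algebra $N$, $N\{t\}$ denotes the set of power series in $t$ with coefficients in $N$, with its natural $\mathbb{C}\{t\}$-module structure. Formal deformation: a formal deformation $\mathcal{N}=N\{t\}$ of $N$ is an associative $\mathbb{C}\{t\}$-bilinear multiplication $\circ_t$ on $N\{t\}$ such that for $a,b\in N$ the constant term (coefficient of $t^0$) of $a\circ_t b$ is the product $ab$ in $N$, and such that the identity element of $N$ acts as the identity of $N\{t\}$. Specialisation: let $d_1,\dots,d_m$ be a basis of $N$ over $\mathbb{C}$ and write $d_i\circ_t d_j=\sum_{l=1}^m g_{i,j,l}(t)\,d_l$ with $g_{i,j,l}(t)\in\mathbb{C}\{t\}$. If all $g_{i,j,l}$ converge at $t=s$, the specialisation $N_s$ of $\mathcal{N}$ at $t=s$ is the $\mathbb{C}$-algebra with basis $d_1,\dots,d_m$ and multiplication $d_i\circ_s d_j=\sum_l g_{i,j,l}(s)\,d_l$. Thus $N_0=N$.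 Strongly flat deformation: let $N$ and $B$ be finite-dimensional $\mathbb{C}$-algebras of the same dimension. A formal deformation $\mathcal{N}$ of $N$ is a strongly flat deformation from $N$ to $B$ if (1) there is a real $c>0$ such that all $g_{i,j,l}(t)$ converge for $t\in[0,c)$ (so $N_s$ is defined for all $s\in[0,c)$), and $N_{t_0}\cong B$ for some $t_0\in(0,c)$; and (2) for every real $\epsilon>0$ there is $s$ with $0<s<\epsilon$ such that $N_s\cong B$. *)

theory Defs
  imports "HOL-Analysis.Analysis" "Jordan_Normal_Form.Matrix"
begin

text \<open>
  A complex algebra is a record of operations on a type that carries an abelian group structure;
  keeping the multiplication in the record (and not in a type class) allows several multiplications
  on the same vector space. The trivial algebra is not excluded.
\<close>

record 'a calgebra =
  alg_scale :: "complex \<Rightarrow> 'a \<Rightarrow> 'a" (infixr "*\<^sub>C\<index>" 75)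
  alg_mult :: "'a \<Rightarrow> 'a \<Rightarrow> 'a" (infixl "\<star>\<index>" 70)
  alg_one :: "'a"

locale complex_algebra = vector_space "alg_scale A"
  for A :: "'a::ab_group_add calgebra" (structure) +
  assumes linear_mult_right: "Vector_Spaces.linear (alg_scale A) (alg_scale A) (\<lambda>b. a \<star> b)"
    and linear_mult_left: "Vector_Spaces.linear (alg_scale A) (alg_scale A) (\<lambda>a. a \<star> b)"
    and mult_assoc: "(a \<star> b) \<star> c = a \<star> (b \<star> c)"
    and one_mult: "alg_one A \<star> a = a"
    and mult_one: "a \<star> alg_one A = a"
begin

definition is_basis :: "'a set \<Rightarrow> bool" where
  "is_basis D \<longleftrightarrow> finite D \<and> independent D \<and> span D = UNIV"

definition finite_dimensional :: bool where
  "finite_dimensional \<longleftrightarrow> (\<exists>D. is_basis D)"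

definition alg_power :: "'a \<Rightarrow> nat \<Rightarrow> 'a" where
  "alg_power a i = ((\<lambda>b. a \<star> b) ^^ i) (alg_one A)"

definition subalgebra :: "'a set \<Rightarrow> bool" where
  "subalgebra S \<longleftrightarrow> subspace S \<and> alg_one A \<in> S \<and> (\<forall>a\<in>S. \<forall>b\<in>S. a \<star> b \<in> S)"

definition generated_by :: "'a set \<Rightarrow> bool" where
  "generated_by G \<longleftrightarrow> subalgebra hull G = UNIV"

definition left_ideal :: "'a set \<Rightarrow> bool" where
  "left_ideal L \<longleftrightarrow> subspace L \<and> (\<forall>a. \<forall>b\<in>L. a \<star> b \<in> L)"

definition two_sided_ideal :: "'a set \<Rightarrow> bool" where
  "two_sided_ideal I \<longleftrightarrow> subspace I \<and> (\<forall>a. \<forall>b\<in>I. a \<star> b \<in> I \<and> b \<star> a \<in> I)"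

definition maximal_left_ideal :: "'a set \<Rightarrow> bool" where
  "maximal_left_ideal L \<longleftrightarrow> left_ideal L \<and> L \<noteq> UNIV \<and>
     (\<forall>L'. left_ideal L' \<and> L \<subseteq> L' \<longrightarrow> L' = L \<or> L' = UNIV)"

definition jacobson_radical :: "'a set" where
  "jacobson_radical = \<Inter>{L. maximal_left_ideal L}"

text \<open>
  Vanishing of the Jacobson radical describes semisimplicity only under a finiteness condition,
  so finite dimension is part of the definition.
\<close>

definition semisimple :: bool where
  "semisimple \<longleftrightarrow> finite_dimensional \<and> jacobson_radical = {0}"

text \<open>
  The algebra is the direct sum of two two-sided ideals \<open>I\<close> and \<open>J\<close>, and \<open>I\<close> is isomorphic to the
  algebra of \<open>j \<times> j\<close> matrices. The map \<open>f\<close> sends the identity matrix to the identity of \<open>I\<close>,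
  which is in general not the identity of the whole algebra.
\<close>

definition has_matrix_summand :: "nat \<Rightarrow> bool" where
  "has_matrix_summand j \<longleftrightarrow>
     (\<exists>I J. two_sided_ideal I \<and> two_sided_ideal J \<and>
        I \<inter> J = {0} \<and> {a + b | a b. a \<in> I \<and> b \<in> J} = UNIV \<and>
        (\<exists>f :: complex mat \<Rightarrow> 'a. bij_betw f (carrier_mat j j) I \<and>
           (\<forall>P \<in> carrier_mat j j. \<forall>Q \<in> carrier_mat j j.
              f (P + Q) = f P + f Q \<and> f (P * Q) = f P \<star> f Q) \<and>
           (\<forall>c. \<forall>P \<in> carrier_mat j j. f (c \<cdot>\<^sub>m P) = c *\<^sub>C f P)))"

end

definition alg_isomorphic ::
    "'a::ab_group_add calgebra \<Rightarrow> 'b::ab_group_add calgebra \<Rightarrow> bool" where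
  "alg_isomorphic A B \<longleftrightarrow>
     (\<exists>f. Vector_Spaces.linear (alg_scale A) (alg_scale B) f \<and> bij f \<and>
        (\<forall>a b. f (a \<star>\<^bsub>A\<^esub> b) = f a \<star>\<^bsub>B\<^esub> f b) \<and> f (alg_one A) = alg_one B)"

text \<open>
  Power series with coefficients in an algebra on the type \<open>'a\<close> are elements of \<open>'a fps\<close>,
  constants being embedded by \<open>fps_const\<close>. A series in \<open>complex fps\<close> acts by the Cauchy product.
\<close>

definition series_scale ::
    "'a::ab_group_add calgebra \<Rightarrow> complex fps \<Rightarrow> 'a fps \<Rightarrow> 'a fps" where
  "series_scale N g v =
     Abs_fps (\<lambda>k. \<Sum>i=0..k. fps_nth g i *\<^sub>C\<^bsub>N\<^esub> fps_nth v (k - i))"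

context complex_algebra
begin

lemma module_series_scale: "Modules.module (series_scale A)"
proof
  fix f g :: "complex fps" and u v :: "'a fps"
  show "series_scale A f (u + v) = series_scale A f u + series_scale A f v"
    by (simp add: fps_eq_iff series_scale_def scale_right_distrib sum.distrib)
  show "series_scale A (f + g) v = series_scale A f v + series_scale A g v"
    by (simp add: fps_eq_iff series_scale_def scale_left_distrib sum.distrib)
  show "series_scale A 1 v = v"
  proof (rule fps_ext)
    fix k
    have "(\<Sum>i=0..k. fps_nth 1 i *\<^sub>C fps_nth v (k - i))
        = (\<Sum>i\<in>{0}. fps_nth 1 i *\<^sub>C fps_nth v (k - i))"
      by (rule sum.mono_neutral_right) auto
    then show "fps_nth (series_scale A 1 v) k = fps_nth v k"
      by (simp add: series_scale_def)
  qed
  show "series_scale A f (series_scale A g v) = series_scale A (f * g) v"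
  proof (rule fps_ext)
    fix k
    have "(\<Sum>j=0..k. \<Sum>i=0..j. (fps_nth f i * fps_nth g (j - i)) *\<^sub>C fps_nth v (k - j))
        = (\<Sum>j=0..k. \<Sum>i=0..k - j. (fps_nth f j * fps_nth g i) *\<^sub>C fps_nth v (k - j - i))"
      by (rule fps_mult_assoc_lemma)
    then show "fps_nth (series_scale A f (series_scale A g v)) k
        = fps_nth (series_scale A (f * g) v) k"
      by (simp add: series_scale_def fps_mult_nth scale_sum_right scale_sum_left)
  qed
qed

text \<open>
  Throughout, \<open>M\<close> is the multiplication of the deformation, a map on series;
  the underlying module is always \<open>'a fps\<close> with \<open>series_scale A\<close>.
\<close>

definition formal_deformation :: "('a fps \<Rightarrow> 'a fps \<Rightarrow> 'a fps) \<Rightarrow> bool" where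
  "formal_deformation M \<longleftrightarrow>
     (\<forall>u. module_hom (series_scale A) (series_scale A) (\<lambda>v. M u v)) \<and>
     (\<forall>v. module_hom (series_scale A) (series_scale A) (\<lambda>u. M u v)) \<and>
     (\<forall>u v w. M (M u v) w = M u (M v w)) \<and>
     (\<forall>a b. fps_nth (M (fps_const a) (fps_const b)) 0 = a \<star> b) \<and>
     (\<forall>v. M (fps_const (alg_one A)) v = v \<and> M v (fps_const (alg_one A)) = v)"

text \<open>
  For \<open>d\<close>, \<open>e\<close>, \<open>l\<close> in a basis \<open>D\<close>, the series \<open>structure_series D M d e l\<close> is the coefficient
  of \<open>l\<close> in the product of \<open>d\<close> and \<open>e\<close>, the basis being indexed by itself.
\<close>

definition structure_series ::
    "'a set \<Rightarrow> ('a fps \<Rightarrow> 'a fps \<Rightarrow> 'a fps) \<Rightarrow> 'a \<Rightarrow> 'a \<Rightarrow> 'a \<Rightarrow> complex fps" where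
  "structure_series D M d e l =
     Abs_fps (\<lambda>k. representation D (fps_nth (M (fps_const d) (fps_const e)) k) l)"

lemma structure_series_expansion:
  assumes "is_basis D"
  shows "M (fps_const d) (fps_const e)
       = (\<Sum>l\<in>D. series_scale A (structure_series D M d e l) (fps_const l))"
proof (rule fps_ext)
  fix k
  let ?v = "fps_nth (M (fps_const d) (fps_const e)) k"
  have *: "fps_nth (series_scale A g (fps_const l)) k = fps_nth g k *\<^sub>C l"
    for g :: "complex fps" and l :: 'a
  proof -
    have "(\<Sum>i=0..k. fps_nth g i *\<^sub>C fps_nth (fps_const l) (k - i))
        = (\<Sum>i\<in>{k}. fps_nth g i *\<^sub>C fps_nth (fps_const l) (k - i))"
      by (rule sum.mono_neutral_right) auto
    then show ?thesis by (simp add: series_scale_def)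
  qed
  have "(\<Sum>l\<in>D. representation D ?v l *\<^sub>C l) = ?v"
    using assms by (intro sum_representation_eq) (auto simp: is_basis_def)
  then show "fps_nth (M (fps_const d) (fps_const e)) k
      = fps_nth (\<Sum>l\<in>D. series_scale A (structure_series D M d e l) (fps_const l)) k"
    by (simp add: fps_sum_nth * structure_series_def)
qed

definition converges_at :: "'a set \<Rightarrow> ('a fps \<Rightarrow> 'a fps \<Rightarrow> 'a fps) \<Rightarrow> complex \<Rightarrow> bool" where
  "converges_at D M s \<longleftrightarrow>
     (\<forall>d\<in>D. \<forall>e\<in>D. \<forall>l\<in>D. summable (\<lambda>k. fps_nth (structure_series D M d e l) k * s ^ k))"

text \<open>
  The specialisation lives on the same vector space; its multiplication is the bilinear extension
  of the evaluated structure constants. It is meaningful only if \<open>converges_at D M s\<close>.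
\<close>

definition specialisation ::
    "'a set \<Rightarrow> ('a fps \<Rightarrow> 'a fps \<Rightarrow> 'a fps) \<Rightarrow> complex \<Rightarrow> 'a calgebra" where
  "specialisation D M s =
     \<lparr>alg_scale = alg_scale A,
      alg_mult = (\<lambda>a b. \<Sum>d\<in>D. \<Sum>e\<in>D. (representation D a d * representation D b e) *\<^sub>C
                     (\<Sum>l\<in>D. eval_fps (structure_series D M d e l) s *\<^sub>C l)),
      alg_one = alg_one A\<rparr>"

end

text \<open>
  A change of basis acts on the structure series by constant invertible matrices, so neither
  convergence nor the isomorphism type of a specialisation depends on the basis \<open>D\<close>.
  In the last clause \<open>converges_at\<close> says that the specialisation at \<open>s\<close> is defined.
\<close>

definition strongly_flat_deformation ::
    "'a::ab_group_add calgebra \<Rightarrow> 'b::ab_group_add calgebra \<Rightarrow>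
     ('a fps \<Rightarrow> 'a fps \<Rightarrow> 'a fps) \<Rightarrow> bool" where
  "strongly_flat_deformation N B M \<longleftrightarrow>
     complex_algebra N \<and> complex_algebra.finite_dimensional N \<and>
     complex_algebra B \<and> complex_algebra.finite_dimensional B \<and>
     vector_space.dim (alg_scale N) UNIV = vector_space.dim (alg_scale B) UNIV \<and>
     complex_algebra.formal_deformation N M \<and>
     (\<exists>D. complex_algebra.is_basis N D \<and>
        (\<exists>c>0::real. (\<forall>s::real. 0 \<le> s \<and> s < c \<longrightarrow>
                  complex_algebra.converges_at N D M (of_real s)) \<and>
               (\<exists>t0::real. 0 < t0 \<and> t0 < c \<and>
                  alg_isomorphic (complex_algebra.specialisation N D M (of_real t0)) B)) \<and>
        (\<forall>\<epsilon>>0::real. \<exists>s::real. 0 < s \<and> s < \<epsilon> \<and>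
           complex_algebra.converges_at N D M (of_real s) \<and>
           alg_isomorphic (complex_algebra.specialisation N D M (of_real s)) B))"

end

theory Submission
  imports Defs "Jordan_Normal_Form.Char_Poly"
begin

text \<open>
  Two facts contradict each other.

  The first is that spanning is an open condition. In the specialisation at \<open>s\<close> the powers
  \<open>x\<^sup>i\<close> and the products \<open>y x\<^sup>i\<close> have coordinates that are polynomials in the structure
  constants, hence tend to their values in the undeformed algebra as \<open>s\<close> decreases to \<open>0\<close>. These
  limits span, so for small \<open>s\<close> the elements \<open>x\<^sup>i\<close> and \<open>y x\<^sup>i\<close>, formed in the
  specialisation, are still spanning. This is used in dual form: for small \<open>s\<close> a linear functional
  that kills all of them is zero (\<open>eventually_no_annihilating_functional\<close>).

  The second is that an algebra with a summand \<open>M\<^sub>j(\<complex>)\<close>, \<open>j > 2\<close>, is never spanned by elements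
  \<open>X\<^sup>i\<close> and \<open>Y X\<^sup>i\<close>. It acts on \<open>\<complex>\<^sup>j\<close> through that summand. If \<open>v\<close> is an
  eigenvector of \<open>X\<close>, the elements \<open>X\<^sup>i\<close> and \<open>Y X\<^sup>i\<close> send \<open>v\<close> into the span of \<open>v\<close> and
  \<open>Y v\<close>, a proper subspace, whereas matrices send \<open>v\<close> to every vector. For a vector \<open>w\<close>
  orthogonal to \<open>v\<close> and \<open>Y v\<close>, the matrix coefficient \<open>P \<mapsto> w \<bullet> (P v)\<close> is therefore a
  nonzero functional that kills all of them (\<open>matrix_summand_annihilating_functional\<close>).

  A strongly flat deformation supplies arbitrarily small \<open>s\<close> at which the specialisation is
  isomorphic to the target. Pulling the functional back along the isomorphism, for \<open>X\<close> and \<open>Y\<close>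
  the images of \<open>x\<close> and \<open>y\<close>, gives the contradiction.
\<close>

unbundle no vec_syntax
unbundle no inner_syntax

section \<open>Two vectors do not span a space of dimension greater than two\<close>

text \<open>
  Only the first three coordinates matter, and there the cross product of \<open>a\<close> and \<open>b\<close> is
  orthogonal to both. If it vanishes, the two truncated vectors are parallel and a vector
  orthogonal to a nonzero one of them will do. The product \<open>\<bullet>\<close> is bilinear, without conjugation.
\<close>

lemma exists_orthogonal_to_pair:
  fixes a b :: "complex vec"
  assumes "a \<in> carrier_vec n" "b \<in> carrier_vec n" "n > 2"
  shows "\<exists>w \<in> carrier_vec n. w \<noteq> 0\<^sub>v n \<and> w \<bullet> a = 0 \<and> w \<bullet> b = 0"
proof -
  have witness: ?thesis
    if "p * a $ 0 + q * a $ 1 + r * a $ 2 = 0" "p * b $ 0 + q * b $ 1 + r * b $ 2 = 0"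
      and "p \<noteq> 0 \<or> q \<noteq> 0 \<or> r \<noteq> 0" for p q r :: complex
  proof -
    define w where
      "w = Matrix.vec n (\<lambda>i. if i = 0 then p else if i = 1 then q else if i = 2 then r else 0)"
    have w: "w \<in> carrier_vec n" by (simp add: w_def)
    have prod: "w \<bullet> u = p * u $ 0 + q * u $ 1 + r * u $ 2" if "u \<in> carrier_vec n" for u
    proof -
      have "w \<bullet> u = (\<Sum>i\<in>{0..<n}. w $ i * u $ i)"
        using that by (simp add: scalar_prod_def)
      also have "\<dots> = (\<Sum>i\<in>{0,1,2}. w $ i * u $ i)"
        using \<open>n > 2\<close> by (intro sum.mono_neutral_right) (auto simp: w_def)
      also have "\<dots> = p * u $ 0 + q * u $ 1 + r * u $ 2"
        using \<open>n > 2\<close> by (simp add: w_def)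
      finally show ?thesis .
    qed
    have "w $ 0 = p" "w $ 1 = q" "w $ 2 = r" using \<open>n > 2\<close> by (auto simp: w_def)
    then have "w \<noteq> 0\<^sub>v n" using that(3) \<open>n > 2\<close> by auto
    then show ?thesis using w prod assms that(1,2) by auto
  qed
  let ?p = "a $ 1 * b $ 2 - a $ 2 * b $ 1"
  let ?q = "a $ 2 * b $ 0 - a $ 0 * b $ 2"
  let ?r = "a $ 0 * b $ 1 - a $ 1 * b $ 0"
  consider "?p \<noteq> 0 \<or> ?q \<noteq> 0 \<or> ?r \<noteq> 0"
    | "?p = 0" "?q = 0" "?r = 0" "a $ 0 \<noteq> 0 \<or> a $ 1 \<noteq> 0"
    | "?p = 0" "?q = 0" "?r = 0" "b $ 0 \<noteq> 0 \<or> b $ 1 \<noteq> 0"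
    | "a $ 0 = 0" "a $ 1 = 0" "b $ 0 = 0" "b $ 1 = 0"
    by blast
  then show ?thesis
  proof cases
    case 1
    then show ?thesis by (intro witness[of ?p ?q ?r]) (simp_all add: algebra_simps)
  next
    case 2
    have "- (a $ 1) * b $ 0 + a $ 0 * b $ 1 + 0 * b $ 2 = ?r" by simp
    then show ?thesis using 2(3,4)
      by (intro witness[of "- (a $ 1)" "a $ 0" 0]) (simp, metis, metis neg_equal_0_iff_equal)
  next
    case 3
    have "- (b $ 1) * a $ 0 + b $ 0 * a $ 1 + 0 * a $ 2 = - ?r" by (simp add: mult.commute)
    then show ?thesis using 3(3,4)
      by (intro witness[of "- (b $ 1)" "b $ 0" 0]) (metis neg_equal_0_iff_equal, simp, metis neg_equal_0_iff_equal)
  next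
    case 4
    then show ?thesis by (intro witness[of 1 0 0]) auto
  qed
qed

text \<open>
  The matrix unit that carries a nonzero coordinate of \<open>v\<close> to a nonzero coordinate of \<open>w\<close>
  detects both.
\<close>

lemma matrix_coefficient_nonzero:
  fixes v w :: "complex vec"
  assumes "v \<in> carrier_vec n" "w \<in> carrier_vec n" "v \<noteq> 0\<^sub>v n" "w \<noteq> 0\<^sub>v n"
  shows "\<exists>P \<in> carrier_mat n n. w \<bullet> (P *\<^sub>v v) \<noteq> 0"
proof -
  obtain k where k: "k < n" "w $ k \<noteq> 0"
    using assms(2,4) by (metis carrier_vecD eq_vecI index_zero_vec)
  obtain l where l: "l < n" "v $ l \<noteq> 0"
    using assms(1,3) by (metis carrier_vecD eq_vecI index_zero_vec)
  define P :: "complex mat" where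
    "P = Matrix.mat n n (\<lambda>(i, m). if i = k \<and> m = l then 1 else 0)"
  have entry: "(P *\<^sub>v v) $ i = (if i = k then v $ l else 0)" if "i < n" for i
  proof -
    have "(P *\<^sub>v v) $ i = (\<Sum>m\<in>{0..<n}. (if i = k \<and> m = l then 1 else 0) * v $ m)"
      using that assms(1) by (simp add: P_def scalar_prod_def)
    also have "\<dots> = (\<Sum>m\<in>{l}. (if i = k \<and> m = l then 1 else 0) * v $ m)"
      using l by (intro sum.mono_neutral_right) auto
    finally show ?thesis by simp
  qed
  have "w \<bullet> (P *\<^sub>v v) = (\<Sum>i\<in>{0..<n}. w $ i * (P *\<^sub>v v) $ i)"
    by (simp add: scalar_prod_def P_def)
  also have "\<dots> = (\<Sum>i\<in>{k}. w $ i * (P *\<^sub>v v) $ i)"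
    using k by (intro sum.mono_neutral_right) (auto simp: entry)
  also have "\<dots> \<noteq> 0" using k l by (simp add: entry)
  finally show ?thesis by (intro bexI[of _ P]) (auto simp: P_def)
qed

section \<open>Large matrix summands\<close>

context complex_algebra
begin

lemma mult_add_right: "a \<star> (b + c) = a \<star> b + a \<star> c"
  and mult_add_left: "(a + b) \<star> c = a \<star> c + b \<star> c"
  and mult_scale_right: "a \<star> (k *\<^sub>C b) = k *\<^sub>C (a \<star> b)"
  and mult_scale_left: "(k *\<^sub>C a) \<star> b = k *\<^sub>C (a \<star> b)"
proof -
  interpret r: Vector_Spaces.linear "alg_scale A" "alg_scale A" "\<lambda>w. u \<star> w" for u
    by (rule linear_mult_right)
  interpret l: Vector_Spaces.linear "alg_scale A" "alg_scale A" "\<lambda>w. w \<star> u" for u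
    by (rule linear_mult_left)
  show "a \<star> (b + c) = a \<star> b + a \<star> c" by (rule r.add)
  show "(a + b) \<star> c = a \<star> c + b \<star> c" by (rule l.add)
  show "a \<star> (k *\<^sub>C b) = k *\<^sub>C (a \<star> b)" by (rule r.scale)
  show "(k *\<^sub>C a) \<star> b = k *\<^sub>C (a \<star> b)" by (rule l.scale)
qed

lemma alg_power_0: "alg_power a 0 = alg_one A"
  and alg_power_Suc: "alg_power a (Suc i) = a \<star> alg_power a i"
  by (simp_all add: alg_power_def)

text \<open>
  A matrix summand \<open>I\<close> is also a quotient: the projection along the complementary ideal \<open>J\<close> is
  multiplicative, since changing a factor by an element of \<open>J\<close> changes the product by one. It sends
  the identity of the whole algebra to the identity matrix because it is onto.
\<close>

lemma matrix_summand_projection: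
  assumes "has_matrix_summand j"
  shows "\<exists>\<phi> :: 'a \<Rightarrow> complex mat.
    (\<forall>a. \<phi> a \<in> carrier_mat j j) \<and>
    (\<forall>P \<in> carrier_mat j j. \<exists>a. \<phi> a = P) \<and>
    (\<forall>a b. \<phi> (a + b) = \<phi> a + \<phi> b) \<and>
    (\<forall>k a. \<phi> (k *\<^sub>C a) = k \<cdot>\<^sub>m \<phi> a) \<and>
    (\<forall>a b. \<phi> (a \<star> b) = \<phi> a * \<phi> b) \<and>
    \<phi> (alg_one A) = 1\<^sub>m j"
proof -
  obtain I J where
    I: "two_sided_ideal I" and J: "two_sided_ideal J" and IJ: "I \<inter> J = {0}"
    and sum: "{a + b | a b. a \<in> I \<and> b \<in> J} = UNIV"
    and iso: "\<exists>f :: complex mat \<Rightarrow> 'a. bij_betw f (carrier_mat j j) I \<and>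
           (\<forall>P \<in> carrier_mat j j. \<forall>Q \<in> carrier_mat j j.
              f (P + Q) = f P + f Q \<and> f (P * Q) = f P \<star> f Q) \<and>
           (\<forall>c. \<forall>P \<in> carrier_mat j j. f (c \<cdot>\<^sub>m P) = c *\<^sub>C f P)"
    using assms unfolding has_matrix_summand_def 
    by (elim exE conjE)
      (rule that, assumption, assumption, assumption, assumption, intro exI conjI, assumption+)
  obtain f :: "complex mat \<Rightarrow> 'a" where f: "bij_betw f (carrier_mat j j) I"
    and f_add: "\<And>P Q. P \<in> carrier_mat j j \<Longrightarrow> Q \<in> carrier_mat j j \<Longrightarrow> f (P + Q) = f P + f Q"
    and f_mult: "\<And>P Q. P \<in> carrier_mat j j \<Longrightarrow> Q \<in> carrier_mat j j \<Longrightarrow> f (P * Q) = f P \<star> f Q"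
    and f_scale: "\<And>c P. P \<in> carrier_mat j j \<Longrightarrow> f (c \<cdot>\<^sub>m P) = c *\<^sub>C f P"
    using iso by blast
  have subI: "subspace I" and subJ: "subspace J"
    and idI: "\<And>a b. b \<in> I \<Longrightarrow> a \<star> b \<in> I \<and> b \<star> a \<in> I"
    and idJ: "\<And>a b. b \<in> J \<Longrightarrow> a \<star> b \<in> J \<and> b \<star> a \<in> J"
    using I J by (auto simp: two_sided_ideal_def)
  have ex: "\<exists>P. P \<in> carrier_mat j j \<and> a - f P \<in> J" for a
  proof -
    obtain p q where "a = p + q" "p \<in> I" "q \<in> J" using sum by blast
    moreover from \<open>p \<in> I\<close> obtain P where "P \<in> carrier_mat j j" "f P = p"
      using f by (auto simp: bij_betw_def)
    ultimately show ?thesis by (intro exI[of _ P]) auto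
  qed
  \<comment> \<open>The value at \<open>a\<close> is the matrix that represents \<open>a\<close> modulo \<open>J\<close>; \<open>eqI\<close> says
      that it is the only one.\<close>
  define \<phi> where "\<phi> a = (SOME P. P \<in> carrier_mat j j \<and> a - f P \<in> J)" for a
  have car: "\<phi> a \<in> carrier_mat j j" and diff: "a - f (\<phi> a) \<in> J" for a
    using someI_ex[OF ex[of a]] by (auto simp: \<phi>_def)
  have f_in: "f P \<in> I" if "P \<in> carrier_mat j j" for P
    using that f by (auto simp: bij_betw_def)
  have eqI: "\<phi> a = P" if "P \<in> carrier_mat j j" "a - f P \<in> J" for a P
  proof -
    have "f (\<phi> a) - f P = (a - f P) - (a - f (\<phi> a))" by simp
    then have "f (\<phi> a) - f P \<in> J" using subspace_diff[OF subJ that(2) diff] by metis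
    moreover have "f (\<phi> a) - f P \<in> I" using subspace_diff[OF subI] f_in car that by blast
    ultimately have "f (\<phi> a) - f P = 0" using IJ by blast
    then have "f (\<phi> a) = f P" by simp
    then show ?thesis using f car that(1) by (auto simp: bij_betw_def inj_on_def)
  qed
  have retraction: "\<phi> (f P) = P" if "P \<in> carrier_mat j j" for P
    using that subspace_0[OF subJ] by (intro eqI) auto
  have mult: "\<phi> (a \<star> b) = \<phi> a * \<phi> b" for a b
  proof (rule eqI)
    show "\<phi> a * \<phi> b \<in> carrier_mat j j" using car[of a] car[of b] by simp
    have "a \<star> b - f (\<phi> a * \<phi> b) = a \<star> (b - f (\<phi> b)) + (a - f (\<phi> a)) \<star> f (\<phi> b)"
      using mult_add_right[of a "b - f (\<phi> b)" "f (\<phi> b)"]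
        mult_add_left[of "a - f (\<phi> a)" "f (\<phi> a)" "f (\<phi> b)"] f_mult[OF car car, of a b]
      by (simp add: algebra_simps)
    then show "a \<star> b - f (\<phi> a * \<phi> b) \<in> J"
      using subspace_add[OF subJ] idJ diff by metis
  qed
  show ?thesis
  proof (intro exI[of _ \<phi>] conjI allI ballI)
    show "\<phi> a \<in> carrier_mat j j" for a by (rule car)
    show "\<exists>a. \<phi> a = P" if "P \<in> carrier_mat j j" for P using retraction[OF that] by blast
    show "\<phi> (a \<star> b) = \<phi> a * \<phi> b" for a b by (rule mult)
    show "\<phi> (a + b) = \<phi> a + \<phi> b" for a b
    proof (rule eqI)
      have "a + b - f (\<phi> a + \<phi> b) = (a - f (\<phi> a)) + (b - f (\<phi> b))"
        by (simp add: f_add[OF car car])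
      then show "a + b - f (\<phi> a + \<phi> b) \<in> J" using subspace_add[OF subJ diff diff] by metis
    qed (use car[of a] car[of b] in simp)
    show "\<phi> (k *\<^sub>C a) = k \<cdot>\<^sub>m \<phi> a" for k a
    proof (rule eqI)
      have "k *\<^sub>C a - f (k \<cdot>\<^sub>m \<phi> a) = k *\<^sub>C (a - f (\<phi> a))"
        by (simp add: f_scale[OF car] scale_right_diff_distrib)
      then show "k *\<^sub>C a - f (k \<cdot>\<^sub>m \<phi> a) \<in> J" using subspace_scale[OF subJ diff] by metis
    qed (use car[of a] in simp)
    \<comment> \<open>The product of the identity with a preimage of the identity matrix is computed in both algebras.\<close>
    have "\<phi> (alg_one A) = \<phi> (alg_one A) * \<phi> (f (1\<^sub>m j))"
      using retraction[of "1\<^sub>m j"] car[of "alg_one A"] by simp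
    also have "\<dots> = \<phi> (f (1\<^sub>m j))" by (simp only: mult[symmetric] one_mult)
    finally show "\<phi> (alg_one A) = 1\<^sub>m j" using retraction[of "1\<^sub>m j"] by simp
  qed
qed

text \<open>
  On an eigenvector \<open>v\<close> of \<open>X\<close> the powers of \<open>X\<close> act by scalars, so the whole family moves
  \<open>v\<close> only within the span of \<open>v\<close> and \<open>Y v\<close>. In dimension above two some nonzero \<open>w\<close> is
  orthogonal to that span, and the matrix coefficient of \<open>w\<close> and \<open>v\<close> is the functional sought.
\<close>

lemma matrix_summand_annihilating_functional:
  assumes "has_matrix_summand j" "j > 2"
  shows "\<exists>h. Vector_Spaces.linear (alg_scale A) (*) h \<and> (\<exists>a. h a \<noteq> 0) \<and>
    (\<forall>i. h (alg_power X i) = 0) \<and> (\<forall>i. h (Y \<star> alg_power X i) = 0)"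
proof -
  obtain \<phi> :: "'a \<Rightarrow> complex mat" where
    car: "\<And>a. \<phi> a \<in> carrier_mat j j"
    and surj: "\<And>P. P \<in> carrier_mat j j \<Longrightarrow> \<exists>a. \<phi> a = P"
    and add: "\<And>a b. \<phi> (a + b) = \<phi> a + \<phi> b"
    and scale: "\<And>k a. \<phi> (k *\<^sub>C a) = k \<cdot>\<^sub>m \<phi> a"
    and mult: "\<And>a b. \<phi> (a \<star> b) = \<phi> a * \<phi> b"
    and one: "\<phi> (alg_one A) = 1\<^sub>m j"
    using matrix_summand_projection[OF assms(1)] by blast
  have "\<not> constant (poly (char_poly (\<phi> X)))"
    using degree_monic_char_poly[OF car, of X] \<open>j > 2\<close> by (simp add: constant_degree)
  then obtain k where "eigenvalue (\<phi> X) k"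
    using fundamental_theorem_of_algebra eigenvalue_root_char_poly[OF car, of X] by metis
  then obtain v where v: "v \<in> carrier_vec j" "v \<noteq> 0\<^sub>v j" "\<phi> X *\<^sub>v v = k \<cdot>\<^sub>v v"
    using car[of X] by (auto simp: eigenvalue_def eigenvector_def)
  have Yv: "\<phi> Y *\<^sub>v v \<in> carrier_vec j" using car[of Y] v by simp
  obtain w where w: "w \<in> carrier_vec j" "w \<noteq> 0\<^sub>v j" "w \<bullet> v = 0" "w \<bullet> (\<phi> Y *\<^sub>v v) = 0"
    using exists_orthogonal_to_pair[OF v(1) Yv \<open>j > 2\<close>] by blast
  have power: "\<phi> (alg_power X i) *\<^sub>v v = k ^ i \<cdot>\<^sub>v v" for i
  proof (induction i)
    case 0
    then show ?case using v by (simp add: alg_power_0 one)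
  next
    case (Suc i)
    have "\<phi> (alg_power X (Suc i)) *\<^sub>v v = \<phi> X *\<^sub>v (\<phi> (alg_power X i) *\<^sub>v v)"
      by (simp add: alg_power_Suc mult assoc_mult_mat_vec[OF car car v(1)])
    also have "\<dots> = k ^ i \<cdot>\<^sub>v (\<phi> X *\<^sub>v v)"
      using Suc mult_mat_vec[OF car v(1)] by simp
    finally show ?case using v by (simp add: smult_smult_assoc mult.commute)
  qed
  define h where "h a = w \<bullet> (\<phi> a *\<^sub>v v)" for a
  show ?thesis
  proof (intro exI[of _ h] conjI allI)
    have action: "\<phi> a *\<^sub>v v \<in> carrier_vec j" for a using car[of a] v by simp
    show "Vector_Spaces.linear (alg_scale A) (*) h"
    proof (intro Vector_Spaces.linear_iff[THEN iffD2] conjI allI)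
      show "vector_space (alg_scale A)" by unfold_locales
      show "vector_space ((*) :: complex \<Rightarrow> _)" by unfold_locales (auto simp: algebra_simps)
      show "h (a + b) = h a + h b" for a b
        unfolding h_def add add_mult_distrib_mat_vec[OF car car v(1)]
        by (rule scalar_prod_add_distrib[OF w(1) action action])
      have "(c \<cdot>\<^sub>m \<phi> a) *\<^sub>v v = c \<cdot>\<^sub>v (\<phi> a *\<^sub>v v)" for c a
        using car[of a] v by (intro eq_vecI) auto
      then show "h (c *\<^sub>C a) = c * h a" for c a
        using scalar_prod_smult_distrib[OF w(1) action] by (simp add: h_def scale)
    qed
    show "\<exists>a. h a \<noteq> 0"
      using matrix_coefficient_nonzero[OF v(1) w(1) v(2) w(2)] surj unfolding h_def by metis
    show "h (alg_power X i) = 0" for i using v w by (simp add: h_def power)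
    have "\<phi> (Y \<star> alg_power X i) *\<^sub>v v = k ^ i \<cdot>\<^sub>v (\<phi> Y *\<^sub>v v)" for i
      by (simp add: mult assoc_mult_mat_vec[OF car car v(1)] power mult_mat_vec[OF car v(1)])
    then show "h (Y \<star> alg_power X i) = 0" for i
      using scalar_prod_smult_distrib[OF w(1) Yv] w by (simp add: h_def)
  qed
qed

end

section \<open>Spanning sets under a small perturbation\<close>

context complex_algebra
begin

lemma representation_basis_add:
  "is_basis D \<Longrightarrow> representation D (a + b) l = representation D a l + representation D b l"
  by (simp add: is_basis_def representation_add)

lemma representation_basis_scale:
  "is_basis D \<Longrightarrow> representation D (k *\<^sub>C a) l = k * representation D a l"
  by (simp add: is_basis_def representation_scale)

lemma representation_basis_sum:
  "is_basis D \<Longrightarrow> representation D (\<Sum>i\<in>I. v i) l = (\<Sum>i\<in>I. representation D (v i) l)"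
  by (simp add: is_basis_def representation_sum)

lemma basis_expansion: "is_basis D \<Longrightarrow> (\<Sum>d\<in>D. representation D a d *\<^sub>C d) = a"
  by (rule sum_representation_eq) (auto simp: is_basis_def)

text \<open>
  Vectors \<open>w d\<close> close to the basis vectors \<open>d\<close> have a diagonally dominant coordinate matrix.
  Accordingly a functional that kills them is zero: at a basis vector \<open>e\<close> where \<open>h\<close> is largest in
  modulus, \<open>h (w e) = 0\<close> expresses \<open>h e\<close> by terms that together are strictly smaller.
\<close>

lemma functional_zero_if_near_basis:
  assumes D: "is_basis D" and h: "Vector_Spaces.linear (alg_scale A) (*) h"
    and near: "\<And>d e. d \<in> D \<Longrightarrow> e \<in> D \<Longrightarrow>
      cmod (representation D (w d) e - (if e = d then 1 else 0)) < 1 / real (card D)"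
    and zero: "\<And>d. d \<in> D \<Longrightarrow> h (w d) = 0"
  shows "h a = 0"
proof -
  interpret h: Vector_Spaces.linear "alg_scale A" "(*)" h by (rule h)
  have finD: "finite D" using D by (simp add: is_basis_def)
  have h_expand: "h b = (\<Sum>d\<in>D. representation D b d * h d)" for b
    using arg_cong[OF basis_expansion[OF D, of b], of h] by (simp add: h.sum h.scale)
  have "h d = 0" if "d \<in> D" for d
  proof (rule ccontr)
    assume "h d \<noteq> 0"
    have "Max ((\<lambda>d. cmod (h d)) ` D) \<in> (\<lambda>d. cmod (h d)) ` D"
      using finD that by (intro Max_in) auto
    then obtain e where e: "e \<in> D" "cmod (h e) = Max ((\<lambda>d. cmod (h d)) ` D)" by auto
    have max: "cmod (h d') \<le> cmod (h e)" if "d' \<in> D" for d'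
      using finD that by (simp add: e(2))
    have pos: "cmod (h e) > 0" using max[OF that] \<open>h d \<noteq> 0\<close>
      by (meson order_less_le_trans zero_less_norm_iff)
    let ?\<delta> = "\<lambda>d. representation D (w e) d - (if d = e then 1 else 0)"
    have "(\<Sum>d\<in>D. ?\<delta> d * h d) = h (w e) - (\<Sum>d\<in>D. (if d = e then 1 else 0) * h d)"
      unfolding h_expand[of "w e"] by (simp add: left_diff_distrib sum_subtractf)
    also have "(\<Sum>d\<in>D. (if d = e then 1 else 0) * h d) = (\<Sum>d\<in>{e}. (if d = e then 1 else 0) * h d)"
      using e finD by (intro sum.mono_neutral_right) auto
    finally have eq: "- h e = (\<Sum>d\<in>D. ?\<delta> d * h d)" using zero[OF e(1)] by simp
    have "cmod (h e) = cmod (- h e)" by simp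
    also have "\<dots> \<le> (\<Sum>d\<in>D. cmod (?\<delta> d * h d))" unfolding eq by (rule norm_sum)
    also have "\<dots> < (\<Sum>d\<in>D. 1 / real (card D) * cmod (h e))"
    proof (rule sum_strict_mono)
      fix d' assume d': "d' \<in> D"
      have "cmod (?\<delta> d' * h d') \<le> cmod (?\<delta> d') * cmod (h e)"
        using max[OF d'] by (simp add: norm_mult mult_left_mono)
      also have "\<dots> < 1 / real (card D) * cmod (h e)"
        using near[OF e(1) d'] pos by (rule mult_strict_right_mono)
      finally show "cmod (?\<delta> d' * h d') < 1 / real (card D) * cmod (h e)" .
    qed (use finD that in auto)
    also have "\<dots> = cmod (h e)" using finD that by auto
    finally show False by simp
  qed
  then show ?thesis unfolding h_expand[of a] by simp
qed

text \<open>
  The vector space carries no topology, so convergence of a curve is convergence of its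
  coordinates. The filter is that of \<open>s\<close> decreasing to \<open>0\<close>, the side on which the
  specialisations are considered.
\<close>

definition tends_in_coordinates :: "'a set \<Rightarrow> (real \<Rightarrow> 'a) \<Rightarrow> 'a \<Rightarrow> bool" where
  "tends_in_coordinates D w z \<longleftrightarrow>
     (\<forall>l\<in>D. ((\<lambda>s. representation D (w s) l) \<longlongrightarrow> representation D z l) (at_right 0))"

lemma tends_in_coordinates_const: "tends_in_coordinates D (\<lambda>s. z) z"
  by (simp add: tends_in_coordinates_def)

text \<open>
  A vector in the span of the limits is approached inside the perturbed spans: keep the
  coefficients of a linear combination and perturb its vectors. Induction over the span spares a
  choice of coefficients, which would be awkward when different indices give the same limit.
\<close>

lemma curve_in_perturbed_span:
  assumes D: "is_basis D"
    and S: "\<And>t. t \<in> T \<Longrightarrow> tends_in_coordinates D (v t) (z t)"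
    and a: "a \<in> span (z ` T)"
  shows "\<exists>w. tends_in_coordinates D w a \<and> (\<forall>s. w s \<in> span ((\<lambda>t. v t s) ` T))"
  using a
proof (induction rule: span_induct_alt)
  case base
  show ?case by (intro exI[of _ "\<lambda>s. 0"] conjI) (simp_all add: tends_in_coordinates_const span_zero)
next
  case (step c b y)
  then obtain t w where t: "t \<in> T" "b = z t"
    and w: "tends_in_coordinates D w y" "\<And>s. w s \<in> span ((\<lambda>t. v t s) ` T)" by blast
  have "tends_in_coordinates D (\<lambda>s. c *\<^sub>C v t s + w s) (c *\<^sub>C b + y)"
    using S[OF t(1)] w(1) t(2) unfolding tends_in_coordinates_def
    by (auto simp: representation_basis_add[OF D] representation_basis_scale[OF D]
        intro!: tendsto_intros)
  moreover have "c *\<^sub>C v t s + w s \<in> span ((\<lambda>t. v t s) ` T)" for s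
    using t w by (intro span_add span_scale) (auto intro: span_base)
  ultimately show ?case by (intro exI[of _ "\<lambda>s. c *\<^sub>C v t s + w s"]) simp
qed

text \<open>
  This is the openness of spanning in dual form. Every basis vector is a limit of vectors from the
  perturbed spans, and close to \<open>0\<close> these vectors are near enough to the basis for
  \<open>functional_zero_if_near_basis\<close>. The exceptional set of \<open>s\<close> has to be chosen before the
  functional, since in the application the functional depends on \<open>s\<close>.
\<close>

lemma eventually_no_annihilating_functional:
  assumes D: "is_basis D"
    and S: "\<And>t. t \<in> T \<Longrightarrow> tends_in_coordinates D (v t) (z t)"
    and spanning: "span (z ` T) = UNIV"
  shows "\<forall>\<^sub>F s in at_right 0. \<forall>h. Vector_Spaces.linear (alg_scale A) (*) h \<longrightarrow>
    (\<forall>t\<in>T. h (v t s) = 0) \<longrightarrow> (\<forall>a. h a = 0)"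
proof -
  have finD: "finite D" using D by (simp add: is_basis_def)
  obtain w where w: "\<And>d. tends_in_coordinates D (w d) d"
    "\<And>d s. w d s \<in> span ((\<lambda>t. v t s) ` T)"
    using curve_in_perturbed_span[where v = v and z = z, OF D S] spanning by (metis UNIV_I)
  have "\<forall>\<^sub>F s in at_right 0. \<forall>d\<in>D. \<forall>e\<in>D.
    cmod (representation D (w d s) e - (if e = d then 1 else 0)) < 1 / real (card D)"
  proof (intro eventually_ball_finite ballI finD)
    fix d e assume de: "d \<in> D" "e \<in> D"
    then have "((\<lambda>s. representation D (w d s) e) \<longlongrightarrow> (if e = d then 1 else 0)) (at_right 0)"
      using w(1)[of d] D by (simp add: tends_in_coordinates_def is_basis_def representation_basis)
    moreover have "1 / real (card D) > 0" using de finD by (auto simp: card_gt_0_iff)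
    ultimately show "\<forall>\<^sub>F s in at_right 0.
        cmod (representation D (w d s) e - (if e = d then 1 else 0)) < 1 / real (card D)"
      unfolding tendsto_iff dist_norm by blast
  qed
  then show ?thesis
  proof eventually_elim
    case (elim s)
    show ?case
    proof (intro allI impI)
      fix h a
      assume h: "Vector_Spaces.linear (alg_scale A) (*) h" and zero: "\<forall>t\<in>T. h (v t s) = 0"
      interpret h: Vector_Spaces.linear "alg_scale A" "(*)" h by (rule h)
      have vanish: "h b = 0" if "b \<in> span ((\<lambda>t. v t s) ` T)" for b
        using that by (induction rule: span_induct_alt) (use zero in \<open>auto simp: h.add h.scale\<close>)
      show "h a = 0"
      proof (rule functional_zero_if_near_basis[OF D h, of "\<lambda>d. w d s"])
        show "cmod (representation D (w d s) e - (if e = d then 1 else 0)) < 1 / real (card D)"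
          if "d \<in> D" "e \<in> D" for d e using elim that by blast
        show "h (w d s) = 0" for d using vanish w(2) by blast
      qed
    qed
  qed
qed

section \<open>Products in the specialisations\<close>

lemma representation_specialisation_mult:
  assumes D: "is_basis D" and l: "l \<in> D"
  shows "representation D (alg_mult (specialisation D M s) a b) l
    = (\<Sum>d\<in>D. \<Sum>e\<in>D. representation D a d * representation D b e
        * eval_fps (structure_series D M d e l) s)"
proof -
  have finD: "finite D" using D by (simp add: is_basis_def)
  have "representation D (\<Sum>m\<in>D. c m *\<^sub>C m) l = c l" for c
  proof -
    have "representation D (\<Sum>m\<in>D. c m *\<^sub>C m) l = (\<Sum>m\<in>D. c m * (if l = m then 1 else 0))"
      using D by (simp add: representation_basis_sum[OF D] representation_basis_scale[OF D]
          is_basis_def representation_basis)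
    also have "\<dots> = (\<Sum>m\<in>{l}. c m * (if l = m then 1 else 0))"
      using l finD by (intro sum.mono_neutral_right) auto
    finally show ?thesis by simp
  qed
  then show ?thesis
    by (simp add: specialisation_def representation_basis_sum[OF D] representation_basis_scale[OF D])
qed

lemma representation_mult:
  assumes D: "is_basis D"
  shows "representation D (a \<star> b) l
    = (\<Sum>d\<in>D. \<Sum>e\<in>D. representation D a d * representation D b e * representation D (d \<star> e) l)"
proof -
  interpret r: Vector_Spaces.linear "alg_scale A" "alg_scale A" "\<lambda>w. u \<star> w" for u
    by (rule linear_mult_right)
  interpret l: Vector_Spaces.linear "alg_scale A" "alg_scale A" "\<lambda>w. w \<star> u" for u
    by (rule linear_mult_left)
  have "a \<star> b = (\<Sum>d\<in>D. representation D a d *\<^sub>C d) \<star> (\<Sum>e\<in>D. representation D b e *\<^sub>C e)"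
    by (simp add: basis_expansion[OF D])
  also have "\<dots> = (\<Sum>d\<in>D. \<Sum>e\<in>D. (representation D a d * representation D b e) *\<^sub>C (d \<star> e))"
    unfolding l.sum r.sum
    by (subst sum.swap) (simp add: mult_scale_left mult_scale_right mult.commute)
  finally have expand: "a \<star> b = \<dots>" .
  show ?thesis
    by (subst expand) (simp add: representation_basis_sum[OF D] representation_basis_scale[OF D])
qed

text \<open>
  Convergence at a single positive real makes the radius of convergence positive, so the structure
  series are continuous at \<open>0\<close>, where their values are the structure constants of the algebra
  itself.
\<close>

lemma structure_series_tendsto:
  assumes M: "formal_deformation M" and "d \<in> D" "e \<in> D" "l \<in> D"
    and c: "c > 0" "converges_at D M (of_real c)"
  shows "((\<lambda>s. eval_fps (structure_series D M d e l) (complex_of_real s))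
    \<longlongrightarrow> representation D (d \<star> e) l) (at_right 0)"
proof -
  let ?g = "structure_series D M d e l"
  have "ereal (norm (complex_of_real c)) \<le> fps_conv_radius ?g"
    unfolding fps_conv_radius_def using assms by (intro conv_radius_geI) (auto simp: converges_at_def)
  then have "fps_conv_radius ?g > 0" using c(1)
    by (metis ereal_less(2) norm_of_real order_less_le_trans zero_less_abs_iff less_irrefl)
  then have "isCont (eval_fps ?g) 0"
    by (intro continuous_on_interior[OF continuous_on_eval_fps])
      (simp add: interior_open in_eball_iff zero_ereal_def)
  then have "(eval_fps ?g \<longlongrightarrow> eval_fps ?g 0) (nhds 0)"
    by (simp add: isCont_def tendsto_at_iff_tendsto_nhds)
  moreover have "filterlim complex_of_real (nhds 0) (at_right 0)"
    using tendsto_of_real[OF tendsto_ident_at, of 0 "{0<..}"] by simp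
  ultimately have "((\<lambda>s. eval_fps ?g (complex_of_real s)) \<longlongrightarrow> eval_fps ?g 0) (at_right 0)"
    by (rule filterlim_compose)
  moreover have "eval_fps ?g 0 = representation D (d \<star> e) l"
    using M by (simp add: eval_fps_at_0 structure_series_def formal_deformation_def)
  ultimately show ?thesis by simp
qed

lemma tends_in_coordinates_mult:
  assumes D: "is_basis D" and M: "formal_deformation M"
    and c: "c > 0" "converges_at D M (of_real c)"
    and "tends_in_coordinates D v a" "tends_in_coordinates D w b"
  shows "tends_in_coordinates D
    (\<lambda>s. alg_mult (specialisation D M (of_real s)) (v s) (w s)) (a \<star> b)"
  unfolding tends_in_coordinates_def
proof
  fix l assume "l \<in> D"
  then show "((\<lambda>s. representation D (alg_mult (specialisation D M (of_real s)) (v s) (w s)) l)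
      \<longlongrightarrow> representation D (a \<star> b) l) (at_right 0)"
    unfolding representation_specialisation_mult[OF D \<open>l \<in> D\<close>] representation_mult[OF D, of a b]
    using assms(5,6) unfolding tends_in_coordinates_def
    by (intro tendsto_sum tendsto_mult structure_series_tendsto[OF M _ _ _ c]) blast+
qed

text \<open>
  The powers are written as iterated multiplications because \<open>alg_power\<close> of a specialisation can
  be unfolded only once that specialisation is known to be an algebra.
\<close>

lemma tends_in_coordinates_power:
  assumes D: "is_basis D" and M: "formal_deformation M"
    and c: "c > 0" "converges_at D M (of_real c)"
  shows "tends_in_coordinates D
    (\<lambda>s. ((\<lambda>b. alg_mult (specialisation D M (of_real s)) x b) ^^ i) (alg_one A)) (alg_power x i)"
proof (induction i)
  case 0
  then show ?case by (simp add: alg_power_0 tends_in_coordinates_const)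
next
  case (Suc i)
  show ?case
    using tends_in_coordinates_mult[OF D M c tends_in_coordinates_const[of D x] Suc]
    by (simp add: alg_power_Suc)
qed

end

section \<open>The obstruction to strongly flat deformations\<close>

theorem corollary24:
  fixes N :: "'a::ab_group_add calgebra" and x y :: 'a
    and A :: "'b::ab_group_add calgebra"
    and n j :: nat
  assumes "complex_algebra N"
    and "complex_algebra.generated_by N {x, y}"
    and "module.span (alg_scale N)
           ({complex_algebra.alg_power N x i | i. i \<le> n} \<union>
            {y \<star>\<^bsub>N\<^esub> complex_algebra.alg_power N x i | i. i \<le> n}) = UNIV"
    and "complex_algebra A"
    and "complex_algebra.semisimple A"
    and "vector_space.dim (alg_scale A) UNIV = vector_space.dim (alg_scale N) UNIV"
    and "j > 2"
    and "complex_algebra.has_matrix_summand A j"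
  shows "\<not> (\<exists>M. strongly_flat_deformation N A M)"
proof
  assume "\<exists>M. strongly_flat_deformation N A M"
  then obtain M where flat: "strongly_flat_deformation N A M" ..
  interpret N: complex_algebra N by fact
  interpret A: complex_algebra A by fact
  have M: "N.formal_deformation M" using flat by (simp add: strongly_flat_deformation_def)
  obtain D where D: "N.is_basis D"
    and near: "\<exists>c>0::real. (\<forall>s::real. 0 \<le> s \<and> s < c \<longrightarrow> N.converges_at D M (of_real s)) \<and>
      (\<exists>t0::real. 0 < t0 \<and> t0 < c \<and> alg_isomorphic (N.specialisation D M (of_real t0)) A)"
    and small: "\<forall>\<epsilon>>0::real. \<exists>s::real. 0 < s \<and> s < \<epsilon> \<and>
      N.converges_at D M (of_real s) \<and> alg_isomorphic (N.specialisation D M (of_real s)) A"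
    using flat unfolding strongly_flat_deformation_def
    by (elim conjE exE[of "\<lambda>D. N.is_basis D \<and> _ D"]) (rule that)
  obtain c where "c > 0" and conv: "\<forall>s::real. 0 \<le> s \<and> s < c \<longrightarrow> N.converges_at D M (of_real s)"
    using near by (elim exE conjE)
  \<comment> \<open>Convergence is known only below \<open>c\<close>, so an interior point is taken.\<close>
  have c: "c / 2 > 0" "N.converges_at D M (of_real (c / 2))"
    using \<open>c > 0\<close> conv[rule_format, of "c / 2"] by auto
  let ?m = "\<lambda>s::real. alg_mult (N.specialisation D M (of_real s))"
  let ?pow = "\<lambda>s i. (?m s x ^^ i) (alg_one N)"
  \<comment> \<open>An index \<open>(with_y, i)\<close> stands for \<open>x\<^sup>i\<close> or \<open>y x\<^sup>i\<close>; \<open>v\<close> forms it in the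
      specialisation and \<open>z\<close> in \<open>N\<close>.\<close>
  define v where "v = (\<lambda>(with_y, i) s. if with_y then ?m s y (?pow s i) else ?pow s i)"
  define z where "z = (\<lambda>(with_y, i). if with_y then y \<star>\<^bsub>N\<^esub> N.alg_power x i else N.alg_power x i)"
  let ?T = "UNIV \<times> {..n} :: (bool \<times> nat) set"
  have "{N.alg_power x i | i. i \<le> n} \<union> {y \<star>\<^bsub>N\<^esub> N.alg_power x i | i. i \<le> n} \<subseteq> z ` ?T"
  proof -
    have "N.alg_power x i = z (False, i)" "y \<star>\<^bsub>N\<^esub> N.alg_power x i = z (True, i)" for i
      by (simp_all add: z_def)
    then show ?thesis by blast
  qed
  then have spanning: "N.span (z ` ?T) = UNIV" using assms(3) N.span_mono by blast
  have "N.tends_in_coordinates D (v t) (z t)" for t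
    using N.tends_in_coordinates_power[OF D M c, where x = x and i = "snd t"]
      N.tends_in_coordinates_mult[OF D M c N.tends_in_coordinates_const[where z = y]
        N.tends_in_coordinates_power[OF D M c, where x = x and i = "snd t"]]
    by (cases t) (auto simp: v_def z_def)
  from N.eventually_no_annihilating_functional[OF D this spanning]
  obtain \<epsilon> where "\<epsilon> > 0" and none: "\<And>s h a. \<lbrakk>0 < s; s < \<epsilon>;
      Vector_Spaces.linear (alg_scale N) (*) h; \<forall>t\<in>?T. h (v t s) = 0\<rbrakk> \<Longrightarrow> h a = 0"
    unfolding eventually_at_right_field by blast
  obtain s :: real where s: "0 < s" "s < \<epsilon>"
    and iso: "alg_isomorphic (N.specialisation D M (of_real s)) A"
    using small[rule_format, OF \<open>\<epsilon> > 0\<close>] by (elim exE conjE)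
  obtain f where f: "Vector_Spaces.linear (alg_scale N) (alg_scale A) f" "bij f"
    and f_mult: "\<And>a b. f (?m s a b) = f a \<star>\<^bsub>A\<^esub> f b" and f_one: "f (alg_one N) = alg_one A"
    using iso unfolding alg_isomorphic_def by (auto simp: N.specialisation_def)
  have f_power: "f (?pow s i) = A.alg_power (f x) i" for i
    by (induction i) (simp_all add: f_one f_mult A.alg_power_0 A.alg_power_Suc)
  obtain h where h: "Vector_Spaces.linear (alg_scale A) (*) h" "\<exists>a. h a \<noteq> 0"
    "\<And>i. h (A.alg_power (f x) i) = 0" "\<And>i. h (f y \<star>\<^bsub>A\<^esub> A.alg_power (f x) i) = 0"
    using A.matrix_summand_annihilating_functional[OF assms(8,7), of "f x" "f y"] by blast
  have "Vector_Spaces.linear (alg_scale N) (*) (h \<circ> f)"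
    using f(1) h(1) by (rule Vector_Spaces.linear_compose)
  moreover have "\<forall>t\<in>?T. (h \<circ> f) (v t s) = 0"
    by (auto simp: v_def f_mult f_power h)
  ultimately have "(h \<circ> f) a = 0" for a using none[OF s] by blast
  then show False using h(2) bij_is_surj[OF f(2)] by (metis comp_apply surjD)
qed

end
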